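(* Consider the program $$(A)\qquad\left\{\begin{array}{l}\arg\min_{\alpha\in\mathbb{R}^m}\|\alpha\|_{GN}^2\\ \text{s.t. } \forall j\in\{1,\dots,m\},\ \bigl|\langle\alpha,e_j\rangle_{GN}-\tilde\alpha_j\bigr|\le\sqrt{r(j,\varepsilon)}\end{array}\right.$$ and the program $$(B)\qquad\arg\min_{\alpha\in\mathbb{R}^m}\left\{\|\alpha\|_{GN}^2-2\sum_{j=1}^m\alpha_j\tilde\alpha_j+2\sum_{j=1}^m\sqrt{r(j,\varepsilon)}\,|\alpha_j|\right\}.$$ Then every solution of (B) is a solution of (A). Moreover, all the solutions $\alpha$ of (A) have the same risk value $\|\alpha-\overline\alpha\|_{GN}^2$. Finally, in the deterministic design case, (B) is equivalent to (i.e. has the same solutions as) $$\arg\min_{\alpha\in\mathbb{R}^m}\left\{\frac1n\sum_{i=1}^n\Bigl[Y_i-\sum_{j=1}^m\alpha_jf_j(X_i)\Bigr]^2+2\sum_{j=1}^m\sqrt{r(j,\varepsilon)}\,|\alpha_j|\right\}.$$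
   Context: Regression setting: one observes $n$ pairs $(X_i,Y_i)$ with $Y_i=f(X_i)+\xi_i$, and one is given a dictionary of functions $f_1,\dots,f_m$ (possibly $m>n$). Two cases are considered. (Deterministic design) $X_1,\dots,X_n$ are deterministic and the noises $\xi_i$ are i.i.d. with mean $0$ and finite second moment. Set $\|\alpha\|_{GN}^2=\|\alpha\|_n^2=\frac1n\sum_{i=1}^n\bigl[\sum_{j=1}^m\alpha_jf_j(X_i)\bigr]^2$ for $\alpha\in\mathbb{R}^m$, and let $\overline\alpha\in\mathbb{R}^m$ be a minimizer of $\alpha\mapsto\frac1n\sum_{i=1}^n\bigl[f(X_i)-\sum_{j=1}^m\alpha_jf_j(X_i)\bigr]^2$. (Random design) The pairs $(X_i,Y_i)$ are i.i.d., the marginal law $\mathbb{P}_X$ of $X_i$ is known, and the noise has mean $0$ and finite second moment. Set $\|\alpha\|_{GN}^2=\|\alpha\|_X^2=\mathbb{E}_{X\sim\mathbb{P}_X}\bigl\{\bigl[\sum_{j=1}^m\alpha_jf_j(X)\bigr]^2\bigr\}$, and let $\overline\alpha\in\mathbb{R}^m$ be a minimizer of $\alpha\mapsto\mathbb{E}_{X\sim\mathbb{P}_X}\bigl\{\bigl[f(X)-\sum_{j=1}^m\alpha_jf_j(X)\bigr]^2\bigr\}$. Except where the deterministic design is specified, the statement applies in either case. $\langle\cdot,\cdot\rangle_{GN}$ is the (possibly degenerate) scalar product associated with $\|\cdot\|_{GN}$ and $e_1,\dots,e_m$ is the canonical basis of $\mathbb{R}^m$. The dictionary is normalized: $\|e_j\|_{GN}=1$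 for all $j$. For $j\in\{1,\dots,m\}$, $\tilde\alpha_j=\frac1n\sum_{i=1}^nf_j(X_i)Y_i$, and $r(j,\varepsilon)\ge 0$ is a (possibly data-dependent) bound attached to a confidence level $\varepsilon\in[0,1]$. *)

theory Defs
  imports "HOL-Probability.Probability"
begin

text \<open>
  The dictionary is \<open>F :: 'm \<Rightarrow> 'x \<Rightarrow> real\<close>, indexed by a finite type of cardinality \<open>m\<close>; the
  coefficient space is \<open>real ^ 'm\<close>, with canonical basis \<open>axis j 1\<close>. Observations are numbered
  by \<open>{1..n}\<close>; values of \<open>X\<close>, \<open>Y\<close>, \<open>\<xi>\<close> at other indices are never used.
\<close>

definition lincomb :: "('m::finite \<Rightarrow> 'x \<Rightarrow> real) \<Rightarrow> real ^ 'm \<Rightarrow> 'x \<Rightarrow> real" where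
  "lincomb F \<alpha> t = (\<Sum>j\<in>UNIV. \<alpha> $ j * F j t)"


subsection \<open>Regression models\<close>

definition (in prob_space) iid_vars ::
    "'b measure \<Rightarrow> (nat \<Rightarrow> 'a \<Rightarrow> 'b) \<Rightarrow> nat set \<Rightarrow> bool" where
  "iid_vars N Z I \<longleftrightarrow>
     indep_vars (\<lambda>_. N) Z I \<and> (\<forall>i\<in>I. \<forall>k\<in>I. distr M N (Z i) = distr M N (Z k))"

locale deterministic_design = prob_space M
  for M :: "'w measure" +
  fixes n :: nat and x :: "nat \<Rightarrow> 'x" and Y :: "nat \<Rightarrow> 'w \<Rightarrow> real"
    and f :: "'x \<Rightarrow> real" and \<xi> :: "nat \<Rightarrow> 'w \<Rightarrow> real"
  assumes n_pos: "0 < n"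
    and model: "\<And>i \<omega>. i \<in> {1..n} \<Longrightarrow> \<omega> \<in> space M \<Longrightarrow> Y i \<omega> = f (x i) + \<xi> i \<omega>"
    and noise_iid: "iid_vars borel \<xi> {1..n}"
    and noise_second_moment: "\<And>i. i \<in> {1..n} \<Longrightarrow> integrable M (\<lambda>\<omega>. (\<xi> i \<omega>)\<^sup>2)"
    and noise_mean: "\<And>i. i \<in> {1..n} \<Longrightarrow> expectation (\<xi> i) = 0"

text \<open>
  \<open>PX\<close> is the marginal law of the design, and also carries the sigma-algebra of the design space.
\<close>

locale random_design = prob_space M
  for M :: "'w measure" +
  fixes PX :: "'x measure"
    and n :: nat and X :: "nat \<Rightarrow> 'w \<Rightarrow> 'x" and Y :: "nat \<Rightarrow> 'w \<Rightarrow> real"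
    and f :: "'x \<Rightarrow> real" and \<xi> :: "nat \<Rightarrow> 'w \<Rightarrow> real"
    and F :: "'m::finite \<Rightarrow> 'x \<Rightarrow> real"
  assumes n_pos: "0 < n"
    and f_measurable: "f \<in> borel_measurable PX"
    and F_measurable: "\<And>j. F j \<in> borel_measurable PX"
    and model: "\<And>i \<omega>. i \<in> {1..n} \<Longrightarrow> \<omega> \<in> space M \<Longrightarrow> Y i \<omega> = f (X i \<omega>) + \<xi> i \<omega>"
    and pairs_iid: "iid_vars (PX \<Otimes>\<^sub>M borel) (\<lambda>i \<omega>. (X i \<omega>, Y i \<omega>)) {1..n}"
    and marginal_law: "\<And>i. i \<in> {1..n} \<Longrightarrow> distr M PX (X i) = PX"
    and noise_second_moment: "\<And>i. i \<in> {1..n} \<Longrightarrow> integrable M (\<lambda>\<omega>. (\<xi> i \<omega>)\<^sup>2)"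
    and noise_mean: "\<And>i. i \<in> {1..n} \<Longrightarrow> expectation (\<xi> i) = 0"


subsection \<open>The two choices of the norm and of the oracle coefficient\<close>

definition sqnorm_n :: "nat \<Rightarrow> (nat \<Rightarrow> 'x) \<Rightarrow> ('m::finite \<Rightarrow> 'x \<Rightarrow> real) \<Rightarrow> real ^ 'm \<Rightarrow> real" where
  "sqnorm_n n x F \<alpha> = 1 / real n * (\<Sum>i=1..n. (lincomb F \<alpha> (x i))\<^sup>2)"

definition sqnorm_X :: "'x measure \<Rightarrow> ('m::finite \<Rightarrow> 'x \<Rightarrow> real) \<Rightarrow> real ^ 'm \<Rightarrow> real" where
  "sqnorm_X PX F \<alpha> = (\<integral>t. (lincomb F \<alpha> t)\<^sup>2 \<partial>PX)"

definition emp_sq_loss ::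
    "nat \<Rightarrow> (nat \<Rightarrow> 'x) \<Rightarrow> (nat \<Rightarrow> real) \<Rightarrow> ('m::finite \<Rightarrow> 'x \<Rightarrow> real) \<Rightarrow> real ^ 'm \<Rightarrow> real" where
  "emp_sq_loss n x y F \<alpha> = 1 / real n * (\<Sum>i=1..n. (y i - lincomb F \<alpha> (x i))\<^sup>2)"

definition oracle_n ::
    "nat \<Rightarrow> (nat \<Rightarrow> 'x) \<Rightarrow> ('x \<Rightarrow> real) \<Rightarrow> ('m::finite \<Rightarrow> 'x \<Rightarrow> real) \<Rightarrow> real ^ 'm \<Rightarrow> bool" where
  "oracle_n n x f F \<alpha>bar \<longleftrightarrow> is_arg_min (emp_sq_loss n x (\<lambda>i. f (x i)) F) (\<lambda>_. True) \<alpha>bar"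

text \<open>
  If every \<open>F j\<close> is square integrable but the measurable \<open>f\<close> is not, the expectation below is
  infinite for all \<open>\<alpha>\<close> while the Bochner integral is 0 for all \<open>\<alpha>\<close>; every vector is a minimizer
  under either convention.
\<close>

definition oracle_X ::
    "'x measure \<Rightarrow> ('x \<Rightarrow> real) \<Rightarrow> ('m::finite \<Rightarrow> 'x \<Rightarrow> real) \<Rightarrow> real ^ 'm \<Rightarrow> bool" where
  "oracle_X PX f F \<alpha>bar \<longleftrightarrow>
     is_arg_min (\<lambda>\<alpha>. \<integral>t. (f t - lincomb F \<alpha> t)\<^sup>2 \<partial>PX) (\<lambda>_. True) \<alpha>bar"


subsection \<open>Scalar product associated with a squared seminorm\<close>

definition assoc_inner :: "('a::real_vector \<Rightarrow> real) \<Rightarrow> 'a \<Rightarrow> 'a \<Rightarrow> real" where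
  "assoc_inner N \<alpha> \<beta> = (N (\<alpha> + \<beta>) - N (\<alpha> - \<beta>)) / 4"

lemma lincomb_add: "lincomb F (\<alpha> + \<beta>) t = lincomb F \<alpha> t + lincomb F \<beta> t"
  by (simp add: lincomb_def distrib_right sum.distrib)

lemma lincomb_diff: "lincomb F (\<alpha> - \<beta>) t = lincomb F \<alpha> t - lincomb F \<beta> t"
  by (simp add: lincomb_def left_diff_distrib sum_subtractf)

lemma lincomb_axis: "lincomb F (axis j 1) t = F j t"
  by (simp add: lincomb_def axis_def if_distrib[where f="\<lambda>c. c * _"] cong: if_cong)

lemma square_polarization: "(a + b)\<^sup>2 - (a - b)\<^sup>2 = 4 * (a * (b::real))"
  by (simp add: power2_eq_square algebra_simps)

lemma assoc_inner_sqnorm_n: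
  "assoc_inner (sqnorm_n n x F) \<alpha> \<beta>
     = 1 / real n * (\<Sum>i=1..n. lincomb F \<alpha> (x i) * lincomb F \<beta> (x i))"
proof -
  have "sqnorm_n n x F (\<alpha> + \<beta>) - sqnorm_n n x F (\<alpha> - \<beta>)
      = 1 / real n * (\<Sum>i=1..n. 4 * (lincomb F \<alpha> (x i) * lincomb F \<beta> (x i)))"
    unfolding sqnorm_n_def lincomb_add lincomb_diff square_polarization[symmetric]
    by (simp add: sum_subtractf right_diff_distrib diff_divide_distrib)
  then show ?thesis
    by (simp add: assoc_inner_def sum_distrib_left[symmetric])
qed

lemma lincomb_square_integrable:
  assumes meas: "\<And>j. F j \<in> borel_measurable PX"
    and sq: "\<And>j. integrable PX (\<lambda>t. (F j t)\<^sup>2)"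
  shows "integrable PX (\<lambda>t. (lincomb F \<alpha> t)\<^sup>2)"
proof -
  have prods: "integrable PX (\<lambda>t. F j t * F k t)" for j k
  proof (rule Bochner_Integration.integrable_bound)
    show "integrable PX (\<lambda>t. (F j t)\<^sup>2 + (F k t)\<^sup>2)"
      using sq by simp
    show "(\<lambda>t. F j t * F k t) \<in> borel_measurable PX"
      using meas by measurable
    have "\<bar>a * b\<bar> \<le> a\<^sup>2 + b\<^sup>2" for a b :: real
    proof -
      have "2 * (\<bar>a\<bar> * \<bar>b\<bar>) \<le> a\<^sup>2 + b\<^sup>2"
        using sum_squares_bound[of "\<bar>a\<bar>" "\<bar>b\<bar>"] by simp
      moreover have "0 \<le> \<bar>a\<bar> * \<bar>b\<bar>" by simp
      ultimately show ?thesis unfolding abs_mult by linarith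
    qed
    then show "AE t in PX. norm (F j t * F k t) \<le> norm ((F j t)\<^sup>2 + (F k t)\<^sup>2)"
      by simp
  qed
  have "(\<lambda>t. (lincomb F \<alpha> t)\<^sup>2)
      = (\<lambda>t. \<Sum>j\<in>UNIV. \<Sum>k\<in>UNIV. (\<alpha> $ j * \<alpha> $ k) * (F j t * F k t))"
    by (simp add: fun_eq_iff lincomb_def power2_eq_square sum_product ac_simps)
  then show ?thesis
    using prods by simp
qed

lemma assoc_inner_sqnorm_X:
  assumes "\<And>j. F j \<in> borel_measurable PX" and "\<And>j. integrable PX (\<lambda>t. (F j t)\<^sup>2)"
  shows "assoc_inner (sqnorm_X PX F) \<alpha> \<beta> = (\<integral>t. lincomb F \<alpha> t * lincomb F \<beta> t \<partial>PX)"
proof -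
  note int = lincomb_square_integrable[OF assms]
  have "sqnorm_X PX F (\<alpha> + \<beta>) - sqnorm_X PX F (\<alpha> - \<beta>)
      = (\<integral>t. (lincomb F (\<alpha> + \<beta>) t)\<^sup>2 - (lincomb F (\<alpha> - \<beta>) t)\<^sup>2 \<partial>PX)"
    unfolding sqnorm_X_def by (rule Bochner_Integration.integral_diff[symmetric]) (rule int)+
  also have "\<dots> = (\<integral>t. 4 * (lincomb F \<alpha> t * lincomb F \<beta> t) \<partial>PX)"
    by (simp add: lincomb_add lincomb_diff square_polarization)
  finally show ?thesis
    by (simp add: assoc_inner_def)
qed

text \<open>The Bochner integral of a non-integrable function is 0, so the normalization of the
  dictionary already contains the square integrability of each \<open>F j\<close>.\<close>

lemma normalized_square_integrable:
  assumes "sqnorm_X PX F (axis j 1) = 1"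
  shows "integrable PX (\<lambda>t. (F j t)\<^sup>2)"
  using assms not_integrable_integral_eq by (fastforce simp: sqnorm_X_def lincomb_axis)


subsection \<open>The programs\<close>

definition emp_coef ::
    "nat \<Rightarrow> (nat \<Rightarrow> 'x) \<Rightarrow> (nat \<Rightarrow> real) \<Rightarrow> ('m \<Rightarrow> 'x \<Rightarrow> real) \<Rightarrow> 'm \<Rightarrow> real" where
  "emp_coef n x y F j = 1 / real n * (\<Sum>i=1..n. F j (x i) * y i)"

definition solves_A ::
    "(real ^ 'm \<Rightarrow> real) \<Rightarrow> ('m::finite \<Rightarrow> real) \<Rightarrow> ('m \<Rightarrow> real) \<Rightarrow> real ^ 'm \<Rightarrow> bool" where
  "solves_A N a r = is_arg_min N (\<lambda>\<alpha>. \<forall>j. \<bar>assoc_inner N \<alpha> (axis j 1) - a j\<bar> \<le> sqrt (r j))"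

definition solves_B ::
    "(real ^ 'm \<Rightarrow> real) \<Rightarrow> ('m::finite \<Rightarrow> real) \<Rightarrow> ('m \<Rightarrow> real) \<Rightarrow> real ^ 'm \<Rightarrow> bool" where
  "solves_B N a r = is_arg_min
     (\<lambda>\<alpha>. N \<alpha> - 2 * (\<Sum>j\<in>UNIV. \<alpha> $ j * a j) + 2 * (\<Sum>j\<in>UNIV. sqrt (r j) * \<bar>\<alpha> $ j\<bar>))
     (\<lambda>_. True)"

definition solves_lasso ::
    "nat \<Rightarrow> (nat \<Rightarrow> 'x) \<Rightarrow> (nat \<Rightarrow> real) \<Rightarrow> ('m::finite \<Rightarrow> 'x \<Rightarrow> real) \<Rightarrow> ('m \<Rightarrow> real)
      \<Rightarrow> real ^ 'm \<Rightarrow> bool" where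
  "solves_lasso n x y F r = is_arg_min
     (\<lambda>\<alpha>. emp_sq_loss n x y F \<alpha> + 2 * (\<Sum>j\<in>UNIV. sqrt (r j) * \<bar>\<alpha> $ j\<bar>)) (\<lambda>_. True)"

end

theory Submission
  imports Defs
begin

text \<open>
  Optimality in (B), tested along the lines \<open>\<alpha> \<plusminus> t e\<^sub>j\<close> and along the ray \<open>(1 - t) \<alpha>\<close>, says that
  \<open>\<alpha>\<close> is feasible for (A) and that \<open>\<parallel>\<alpha>\<parallel>\<^sup>2 + \<Sum>\<^sub>j s\<^sub>j \<bar>\<alpha>\<^sub>j\<bar> \<le> \<Sum>\<^sub>j \<alpha>\<^sub>j a\<^sub>j\<close>, where \<open>s\<^sub>j = sqrt (r\<^sub>j)\<close>.
  For any feasible \<open>\<beta>\<close> this gives \<open>\<parallel>\<alpha>\<parallel>\<^sup>2 \<le> \<Sum>\<^sub>j \<alpha>\<^sub>j \<langle>\<beta>, e\<^sub>j\<rangle> = \<langle>\<alpha>, \<beta>\<rangle>\<close>, whence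
  \<open>\<parallel>\<alpha>\<parallel>\<^sup>2 \<le> \<parallel>\<beta>\<parallel>\<^sup>2\<close> by \<open>\<parallel>\<alpha> - \<beta>\<parallel>\<^sup>2 \<ge> 0\<close>. The feasible set of (A) is convex, so by the parallelogram
  identity two solutions differ by a vector of seminorm zero, which is orthogonal to everything.
\<close>

section \<open>Possibly degenerate scalar products, as common ground for both designs\<close>

locale semi_inner =
  fixes N :: "'a::real_vector \<Rightarrow> real"
  assumes linear_left: "linear (\<lambda>\<alpha>. assoc_inner N \<alpha> \<beta>)"
    and commute: "assoc_inner N \<alpha> \<beta> = assoc_inner N \<beta> \<alpha>"
    and diagonal: "assoc_inner N \<alpha> \<alpha> = N \<alpha>"
    and nonneg: "0 \<le> N \<alpha>"
begin

lemma add_left: "assoc_inner N (\<alpha> + \<beta>) \<gamma> = assoc_inner N \<alpha> \<gamma> + assoc_inner N \<beta> \<gamma>"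
  using linear_add[OF linear_left] .

lemma scale_left: "assoc_inner N (c *\<^sub>R \<alpha>) \<gamma> = c * assoc_inner N \<alpha> \<gamma>"
  using linear_scale[OF linear_left] by simp

lemma N_add_scaled: "N (\<alpha> + t *\<^sub>R \<beta>) = N \<alpha> + 2 * t * assoc_inner N \<alpha> \<beta> + t\<^sup>2 * N \<beta>"
proof -
  have "N (\<alpha> + t *\<^sub>R \<beta>) = assoc_inner N \<alpha> (\<alpha> + t *\<^sub>R \<beta>) + t * assoc_inner N \<beta> (\<alpha> + t *\<^sub>R \<beta>)"
    by (simp only: diagonal[symmetric] add_left scale_left)
  also have "\<dots> = assoc_inner N \<alpha> \<alpha> + t * assoc_inner N \<beta> \<alpha>
      + t * (assoc_inner N \<alpha> \<beta> + t * assoc_inner N \<beta> \<beta>)"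
    by (simp only: commute[of \<alpha> "\<alpha> + t *\<^sub>R \<beta>"] commute[of \<beta> "\<alpha> + t *\<^sub>R \<beta>"] add_left scale_left)
  finally show ?thesis
    by (simp add: diagonal commute[of \<beta> \<alpha>] power2_eq_square algebra_simps)
qed

lemma N_scale: "N (t *\<^sub>R \<alpha>) = t\<^sup>2 * N \<alpha>"
  by (simp add: diagonal[symmetric] scale_left commute[of \<alpha> "t *\<^sub>R \<alpha>"] power2_eq_square)

text \<open>Degenerate case of Cauchy-Schwarz: along a null direction \<open>N\<close> is affine,
  and an affine function bounded below by 0 on the whole line has slope 0.\<close>

lemma N_add_null:
  assumes "N \<beta> = 0"
  shows "N (\<alpha> + \<beta>) = N \<alpha>"
proof -
  have "assoc_inner N \<alpha> \<beta> = 0"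
  proof (rule ccontr)
    define c where "c = assoc_inner N \<alpha> \<beta>"
    assume "assoc_inner N \<alpha> \<beta> \<noteq> 0"
    \<comment> \<open>The coefficient solves \<open>N \<alpha> + 2 * t * c = - 1\<close> for
      t.\<close>
    then have "N (\<alpha> + (- (N \<alpha> + 1) / (2 * c)) *\<^sub>R \<beta>) = - 1"
      using assms unfolding N_add_scaled c_def[symmetric] by (simp add: field_simps)
    then show False
      using nonneg[of "\<alpha> + (- (N \<alpha> + 1) / (2 * c)) *\<^sub>R \<beta>"] by linarith
  qed
  then show ?thesis
    using N_add_scaled[of \<alpha> 1 \<beta>] assms by simp
qed

end

section \<open>From (B) to (A) by first-order conditions\<close>

text \<open>Divide by t and let t tend to 0 from the right. This stands in for a one-sided
  derivative: b bounds the first-order change of the objective of (B), and c is \<open>N\<close> of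
  the direction.\<close>

lemma linear_coeff_nonneg:
  fixes b c :: real
  assumes "\<And>t. 0 < t \<Longrightarrow> t \<le> 1 \<Longrightarrow> 0 \<le> t * b + t\<^sup>2 * c"
  shows "0 \<le> b"
proof (rule tendsto_lowerbound)
  show "((\<lambda>t. b + t * c) \<longlongrightarrow> b) (at_right 0)"
    by (rule tendsto_eq_intros refl | simp)+
  have "0 \<le> b + t * c" if "0 < t" "t < 1" for t
  proof -
    have "0 \<le> t * (b + t * c)"
      using assms[of t] that by (simp add: power2_eq_square algebra_simps)
    then show ?thesis
      using that by (simp add: zero_le_mult_iff)
  qed
  then show "\<forall>\<^sub>F t in at_right 0. 0 \<le> b + t * c"
    unfolding eventually_at_right_field by (intro exI[of _ 1]) auto
qed simp

text \<open>The constraints of (A) see \<beta> only through its products with the basis vectors.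
  Expanding \<alpha> in the canonical basis turns them into control of the product with
  \<alpha>.\<close>

lemma assoc_inner_sum_axis:
  fixes N :: "real ^ 'm::finite \<Rightarrow> real"
  assumes "semi_inner N"
  shows "assoc_inner N \<alpha> \<beta> = (\<Sum>j\<in>UNIV. \<alpha> $ j * assoc_inner N \<beta> (axis j 1))"
proof -
  interpret semi_inner N by fact
  have "assoc_inner N \<alpha> \<beta> = assoc_inner N (\<Sum>j\<in>UNIV. \<alpha> $ j *\<^sub>R axis j 1) \<beta>"
    using basis_expansion[of \<alpha>] by (simp add: scalar_mult_eq_scaleR)
  also have "\<dots> = (\<Sum>j\<in>UNIV. \<alpha> $ j * assoc_inner N \<beta> (axis j 1))"
    by (simp add: linear_sum[OF linear_left] scale_left commute[of \<beta>])
  finally show ?thesis .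
qed

lemma solves_B_imp_solves_A:
  fixes N :: "real ^ 'm::finite \<Rightarrow> real"
  assumes N: "semi_inner N" and r: "\<And>j. 0 \<le> r j" and B: "solves_B N a r \<alpha>"
  shows "solves_A N a r \<alpha>"
proof -
  interpret semi_inner N by fact
  define s where "s j = sqrt (r j)" for j
  have s: "0 \<le> s j" for j
    using r by (simp add: s_def)
  define lin where "lin \<beta> = (\<Sum>j\<in>UNIV. \<beta> $ j * a j)" for \<beta> :: "real ^ 'm"
  define pen where "pen \<beta> = (\<Sum>j\<in>UNIV. s j * \<bar>\<beta> $ j\<bar>)" for \<beta> :: "real ^ 'm"
  have opt: "N \<alpha> - 2 * lin \<alpha> + 2 * pen \<alpha> \<le> N \<beta> - 2 * lin \<beta> + 2 * pen \<beta>" for \<beta>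
    using B by (auto simp: solves_B_def is_arg_min_linorder lin_def pen_def s_def)
  have feasible: "\<bar>assoc_inner N \<alpha> (axis j 1) - a j\<bar> \<le> s j" for j
  proof -
    \<comment> \<open>The right-hand side bounds from above the directional derivative of the
      objective of (B) along \<sigma> times the j-th basis vector. The signs 1 and -1 yield the two
      halves of the constraint.\<close>
    have "0 \<le> 2 * (\<sigma> * (assoc_inner N \<alpha> (axis j 1) - a j) + s j)" if \<sigma>: "\<bar>\<sigma>\<bar> = 1" for \<sigma>
    proof (rule linear_coeff_nonneg)
      fix t :: real
      assume t: "0 < t" "t \<le> 1"
      let ?\<beta> = "\<alpha> + (t * \<sigma>) *\<^sub>R axis j 1"
      have "lin ?\<beta> = (\<Sum>k\<in>UNIV. \<alpha> $ k * a k + (if k = j then t * \<sigma> * a j else 0))"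
        unfolding lin_def by (rule sum.cong) (auto simp: axis_def algebra_simps)
      then have lin: "lin ?\<beta> = lin \<alpha> + t * \<sigma> * a j"
        by (simp add: sum.distrib lin_def)
      \<comment> \<open>An upper bound suffices, since the perturbed point stands on the larger side
        of \<open>opt\<close>; the triangle inequality avoids cases on the sign of
        \<open>\<alpha> $ j\<close>.\<close>
      have "pen ?\<beta> \<le> (\<Sum>k\<in>UNIV. s k * \<bar>\<alpha> $ k\<bar> + (if k = j then t * s j else 0))"
        unfolding pen_def
      proof (rule sum_mono)
        fix k
        have "s j * \<bar>\<alpha> $ j + t * \<sigma>\<bar> \<le> s j * (\<bar>\<alpha> $ j\<bar> + t)"
          using abs_triangle_ineq[of "\<alpha> $ j" "t * \<sigma>"] t \<sigma>
          by (intro mult_left_mono s) (simp add: abs_mult)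
        then show "s k * \<bar>?\<beta> $ k\<bar> \<le> s k * \<bar>\<alpha> $ k\<bar> + (if k = j then t * s j else 0)"
          by (auto simp: axis_def algebra_simps)
      qed
      then have pen: "pen ?\<beta> \<le> pen \<alpha> + t * s j"
        by (simp add: sum.distrib pen_def)
      have "\<sigma>\<^sup>2 = 1"
        using \<sigma> by (metis power2_abs one_power2)
      then have "N ?\<beta> = N \<alpha> + 2 * (t * \<sigma>) * assoc_inner N \<alpha> (axis j 1) + t\<^sup>2 * N (axis j 1)"
        by (simp add: N_add_scaled power_mult_distrib)
      then show "0 \<le> t * (2 * (\<sigma> * (assoc_inner N \<alpha> (axis j 1) - a j) + s j)) + t\<^sup>2 * N (axis j 1)"
        using opt[of ?\<beta>] lin pen by (simp add: algebra_simps)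
    qed
    from this[of 1] this[of "-1"] show ?thesis
      by (simp add: abs_le_iff)
  qed
  \<comment> \<open>Shrinking \<alpha> towards 0: the bound \<open>t \<le> 1\<close> keeps
    \<open>1 - t\<close> nonnegative, so the penalty scales exactly, while \<open>N\<close> picks up
    the factor \<open>1 - 2 * t + t\<^sup>2\<close>.\<close>
  have "0 \<le> 2 * (lin \<alpha> - pen \<alpha> - N \<alpha>)"
  proof (rule linear_coeff_nonneg)
    fix t :: real
    assume t: "0 < t" "t \<le> 1"
    have lin: "lin ((1 - t) *\<^sub>R \<alpha>) = (1 - t) * lin \<alpha>"
      by (simp add: lin_def sum_distrib_left algebra_simps)
    have pen: "pen ((1 - t) *\<^sub>R \<alpha>) = (1 - t) * pen \<alpha>"
      using t by (simp add: pen_def sum_distrib_left abs_mult mult.left_commute)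
    show "0 \<le> t * (2 * (lin \<alpha> - pen \<alpha> - N \<alpha>)) + t\<^sup>2 * N \<alpha>"
      using opt[of "(1 - t) *\<^sub>R \<alpha>"] unfolding lin pen N_scale
      by (simp add: power2_eq_square algebra_simps)
  qed
  then have slack: "N \<alpha> \<le> lin \<alpha> - pen \<alpha>"
    by simp
  have "N \<alpha> \<le> N \<beta>" if \<beta>: "\<forall>j. \<bar>assoc_inner N \<beta> (axis j 1) - a j\<bar> \<le> s j" for \<beta>
  proof -
    have "lin \<alpha> - pen \<alpha> \<le> (\<Sum>j\<in>UNIV. \<alpha> $ j * assoc_inner N \<beta> (axis j 1))"
      unfolding lin_def pen_def sum_subtractf[symmetric]
    proof (rule sum_mono)
      fix j
      \<comment> \<open>Replacing \<open>a j\<close> by the product of \<beta> with the basis vector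
        costs at most \<open>s j * \<bar>\<alpha> $ j\<bar>\<close>, which is the term that
        \<open>pen\<close> subtracts.\<close>
      have "\<bar>\<alpha> $ j * (assoc_inner N \<beta> (axis j 1) - a j)\<bar> \<le> s j * \<bar>\<alpha> $ j\<bar>"
        using mult_left_mono[OF \<beta>[rule_format, of j], of "\<bar>\<alpha> $ j\<bar>"]
        by (simp add: abs_mult mult.commute)
      then show "\<alpha> $ j * a j - s j * \<bar>\<alpha> $ j\<bar> \<le> \<alpha> $ j * assoc_inner N \<beta> (axis j 1)"
        by (simp add: abs_le_iff algebra_simps)
    qed
    with slack have "N \<alpha> \<le> assoc_inner N \<alpha> \<beta>"
      by (simp add: assoc_inner_sum_axis[OF N, of \<alpha> \<beta>])
    moreover have "0 \<le> N \<alpha> - 2 * assoc_inner N \<alpha> \<beta> + N \<beta>"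
      using nonneg[of "\<alpha> + (- 1) *\<^sub>R \<beta>"] unfolding N_add_scaled by simp
    ultimately show ?thesis
      by linarith
  qed
  with feasible show ?thesis
    by (auto simp: solves_A_def is_arg_min_linorder s_def)
qed

section \<open>Uniqueness of the solution of (A) up to null vectors\<close>

lemma solves_A_same_risk:
  fixes N :: "real ^ 'm::finite \<Rightarrow> real"
  assumes N: "semi_inner N" and A: "solves_A N a r \<alpha>" "solves_A N a r \<alpha>'"
  shows "N (\<alpha> - \<gamma>) = N (\<alpha>' - \<gamma>)"
proof -
  interpret semi_inner N by fact
  define \<delta> where "\<delta> = \<alpha>' - \<alpha>"
  define \<mu> where "\<mu> = \<alpha> + (1/2) *\<^sub>R \<delta>"
  \<comment> \<open>The explicit factor 1 lets \<open>N_add_scaled\<close> expand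
    \<open>N \<alpha>'\<close> and \<open>N \<mu>\<close> in the same terms.\<close>
  have \<alpha>': "\<alpha>' = \<alpha> + 1 *\<^sub>R \<delta>"
    by (simp add: \<delta>_def)
  have "\<bar>assoc_inner N \<mu> (axis j 1) - a j\<bar> \<le> sqrt (r j)" for j
  proof -
    have "\<bar>assoc_inner N \<alpha> (axis j 1) - a j\<bar> \<le> sqrt (r j)"
      "\<bar>assoc_inner N \<alpha>' (axis j 1) - a j\<bar> \<le> sqrt (r j)"
      using A by (auto simp: solves_A_def is_arg_min_linorder)
    moreover have "2 * assoc_inner N \<mu> (axis j 1)
        = assoc_inner N \<alpha> (axis j 1) + assoc_inner N \<alpha>' (axis j 1)"
      by (simp add: \<alpha>' \<mu>_def add_left scale_left)
    ultimately show ?thesis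
      by linarith
  qed
  with A have "N \<alpha> \<le> N \<mu>" "N \<alpha>' \<le> N \<mu>"
    by (auto simp: solves_A_def is_arg_min_linorder)
  \<comment> \<open>The parallelogram identity reads
    \<open>N \<alpha> + N \<alpha>' = 2 * N \<mu> + N \<delta> / 2\<close>; adding the two
    inequalities leaves only the last term.\<close>
  then have "N \<delta> \<le> 0"
    unfolding \<mu>_def \<alpha>' N_add_scaled by (simp add: power2_eq_square)
  then have "N \<delta> = 0"
    using nonneg[of \<delta>] by simp
  from N_add_null[OF this, of "\<alpha> - \<gamma>"] show ?thesis
    by (simp add: \<delta>_def)
qed

section \<open>The empirical and the population norm as instances\<close>

lemma lincomb_scale: "lincomb F (c *\<^sub>R \<alpha>) t = c * lincomb F \<alpha> t"
  by (simp add: lincomb_def sum_distrib_left mult.assoc)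

lemma semi_inner_sqnorm_n:
  fixes F :: "'m::finite \<Rightarrow> 'x \<Rightarrow> real"
  shows "semi_inner (sqnorm_n n x F)"
proof (rule semi_inner.intro)
  fix \<alpha> \<beta> :: "real ^ 'm"
  show "linear (\<lambda>\<alpha>. assoc_inner (sqnorm_n n x F) \<alpha> \<beta>)"
    unfolding assoc_inner_sqnorm_n
    by (rule linearI)
      (simp_all add: lincomb_add lincomb_scale sum.distrib sum_distrib_left algebra_simps
        add_divide_distrib)
  show "assoc_inner (sqnorm_n n x F) \<alpha> \<beta> = assoc_inner (sqnorm_n n x F) \<beta> \<alpha>"
    by (simp add: assoc_inner_sqnorm_n mult.commute)
  show "assoc_inner (sqnorm_n n x F) \<alpha> \<alpha> = sqnorm_n n x F \<alpha>"
    by (simp add: assoc_inner_sqnorm_n sqnorm_n_def power2_eq_square)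
  show "0 \<le> sqnorm_n n x F \<alpha>"
    by (simp add: sqnorm_n_def sum_nonneg)
qed

lemma semi_inner_sqnorm_X:
  fixes F :: "'m::finite \<Rightarrow> 'x \<Rightarrow> real"
  assumes meas: "\<And>j. F j \<in> borel_measurable PX" and sq: "\<And>j. integrable PX (\<lambda>t. (F j t)\<^sup>2)"
  shows "semi_inner (sqnorm_X PX F)"
proof (rule semi_inner.intro)
  note inner = assoc_inner_sqnorm_X[where F = F, OF assms]
  \<comment> \<open>Additivity of the Bochner integral rests on integrable products; polarization
    writes them as differences of integrable squares.\<close>
  have int: "integrable PX (\<lambda>t. lincomb F \<alpha> t * lincomb F \<beta> t)" for \<alpha> \<beta>
  proof -
    have "(\<lambda>t. lincomb F \<alpha> t * lincomb F \<beta> t)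
        = (\<lambda>t. ((lincomb F (\<alpha> + \<beta>) t)\<^sup>2 - (lincomb F (\<alpha> - \<beta>) t)\<^sup>2) / 4)"
      by (simp add: lincomb_add lincomb_diff square_polarization)
    then show ?thesis
      using lincomb_square_integrable[where F = F, OF assms]
      by (auto intro: Bochner_Integration.integrable_diff)
  qed
  fix \<alpha> \<beta> :: "real ^ 'm"
  show "linear (\<lambda>\<alpha>. assoc_inner (sqnorm_X PX F) \<alpha> \<beta>)"
    unfolding inner
    by (rule linearI) (simp_all add: lincomb_add lincomb_scale distrib_right mult.assoc int)
  show "assoc_inner (sqnorm_X PX F) \<alpha> \<beta> = assoc_inner (sqnorm_X PX F) \<beta> \<alpha>"
    by (simp add: inner mult.commute)
  show "assoc_inner (sqnorm_X PX F) \<alpha> \<alpha> = sqnorm_X PX F \<alpha>"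
    by (simp add: inner sqnorm_X_def power2_eq_square)
  show "0 \<le> sqnorm_X PX F \<alpha>"
    by (simp add: sqnorm_X_def)
qed

section \<open>The Lasso form in the deterministic design\<close>

text \<open>Expanding the square isolates a summand free of \<alpha>, so the objectives of (B) and
  of the Lasso differ by a constant and have the same minimizers.\<close>

lemma emp_sq_loss_expand:
  "emp_sq_loss n x y F \<alpha> = 1 / real n * (\<Sum>i=1..n. (y i)\<^sup>2)
     + (sqnorm_n n x F \<alpha> - 2 * (\<Sum>j\<in>UNIV. \<alpha> $ j * emp_coef n x y F j))"
proof -
  have "(\<Sum>j\<in>UNIV. \<alpha> $ j * emp_coef n x y F j)
      = 1 / real n * (\<Sum>j\<in>UNIV. \<Sum>i=1..n. \<alpha> $ j * F j (x i) * y i)"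
    by (simp add: emp_coef_def sum_distrib_left sum_divide_distrib mult.assoc)
  also have "\<dots> = 1 / real n * (\<Sum>i=1..n. lincomb F \<alpha> (x i) * y i)"
    \<comment> \<open>Summing over j first reassembles the linear combination at each design
      point.\<close>
    by (subst sum.swap) (simp add: lincomb_def sum_distrib_right)
  finally show ?thesis
    by (simp add: emp_sq_loss_def sqnorm_n_def power2_diff sum.distrib sum_subtractf
        sum_distrib_left sum_divide_distrib diff_divide_distrib add_divide_distrib mult.commute mult.left_commute)
qed

lemma solves_B_iff_solves_lasso:
  "solves_B (sqnorm_n n x F) (emp_coef n x y F) r \<alpha> \<longleftrightarrow> solves_lasso n x y F r \<alpha>"
  by (simp add: solves_B_def solves_lasso_def is_arg_min_linorder emp_sq_loss_expand add.assoc)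

theorem proposition3p1:
  fixes M :: "'w measure" and PX :: "'x measure" and n :: nat
    and x :: "nat \<Rightarrow> 'x" and X :: "nat \<Rightarrow> 'w \<Rightarrow> 'x"
    and Y :: "nat \<Rightarrow> 'w \<Rightarrow> real" and \<xi> :: "nat \<Rightarrow> 'w \<Rightarrow> real"
    and f :: "'x \<Rightarrow> real" and F :: "'m::finite \<Rightarrow> 'x \<Rightarrow> real"
    and r :: "'m \<Rightarrow> real \<Rightarrow> 'w \<Rightarrow> real" and \<epsilon> :: real and \<omega> :: 'w
  assumes level: "0 \<le> \<epsilon>" "\<epsilon> \<le> 1"
    and outcome: "\<omega> \<in> space M"
    and r_nonneg: "\<And>j \<delta> \<omega>'. 0 \<le> \<delta> \<Longrightarrow> \<delta> \<le> 1 \<Longrightarrow> \<omega>' \<in> space M \<Longrightarrow> 0 \<le> r j \<delta> \<omega>'"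
  shows
    "(deterministic_design M n x Y f \<xi> \<and> (\<forall>j. sqnorm_n n x F (axis j 1) = 1) \<longrightarrow>
        (let N = sqnorm_n n x F;
             y = (\<lambda>i. Y i \<omega>);
             a = emp_coef n x y F;
             \<rho> = (\<lambda>j. r j \<epsilon> \<omega>)
         in (\<forall>\<alpha>. solves_B N a \<rho> \<alpha> \<longrightarrow> solves_A N a \<rho> \<alpha>) \<and>
            (\<forall>\<alpha>bar. oracle_n n x f F \<alpha>bar \<longrightarrow>
               (\<forall>\<alpha> \<alpha>'. solves_A N a \<rho> \<alpha> \<and> solves_A N a \<rho> \<alpha>' \<longrightarrow> N (\<alpha> - \<alpha>bar) = N (\<alpha>' - \<alpha>bar))) \<and>
            (\<forall>\<alpha>. solves_B N a \<rho> \<alpha> \<longleftrightarrow> solves_lasso n x y F \<rho> \<alpha>)))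
     \<and>
     (random_design M PX n X Y f \<xi> F \<and> (\<forall>j. sqnorm_X PX F (axis j 1) = 1) \<longrightarrow>
        (let N = sqnorm_X PX F;
             a = emp_coef n (\<lambda>i. X i \<omega>) (\<lambda>i. Y i \<omega>) F;
             \<rho> = (\<lambda>j. r j \<epsilon> \<omega>)
         in (\<forall>\<alpha>. solves_B N a \<rho> \<alpha> \<longrightarrow> solves_A N a \<rho> \<alpha>) \<and>
            (\<forall>\<alpha>bar. oracle_X PX f F \<alpha>bar \<longrightarrow>
               (\<forall>\<alpha> \<alpha>'. solves_A N a \<rho> \<alpha> \<and> solves_A N a \<rho> \<alpha>' \<longrightarrow> N (\<alpha> - \<alpha>bar) = N (\<alpha>' - \<alpha>bar)))))"
proof (intro conjI impI)
  \<comment> \<open>Once \<omega> and \<epsilon> are fixed, the data and the bounds are plain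
    numbers, and the claim becomes deterministic.\<close>
  have \<rho>: "0 \<le> r j \<epsilon> \<omega>" for j
    using r_nonneg level outcome by blast
  note B_imp_A = solves_B_imp_solves_A[where r = "\<lambda>j. r j \<epsilon> \<omega>", OF _ \<rho>]
    and same_risk = solves_A_same_risk[where r = "\<lambda>j. r j \<epsilon> \<omega>"]
  note det = semi_inner_sqnorm_n[of n x F]
  show "let N = sqnorm_n n x F;
             y = (\<lambda>i. Y i \<omega>);
             a = emp_coef n x y F;
             \<rho> = (\<lambda>j. r j \<epsilon> \<omega>)
         in (\<forall>\<alpha>. solves_B N a \<rho> \<alpha> \<longrightarrow> solves_A N a \<rho> \<alpha>) \<and>
            (\<forall>\<alpha>bar. oracle_n n x f F \<alpha>bar \<longrightarrow>
               (\<forall>\<alpha> \<alpha>'. solves_A N a \<rho> \<alpha> \<and> solves_A N a \<rho> \<alpha>' \<longrightarrow> N (\<alpha> - \<alpha>bar) = N (\<alpha>' - \<alpha>bar))) \<and>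
            (\<forall>\<alpha>. solves_B N a \<rho> \<alpha> \<longleftrightarrow> solves_lasso n x y F \<rho> \<alpha>)"
    unfolding Let_def solves_B_iff_solves_lasso[symmetric]
    using B_imp_A[OF det] same_risk[OF det] by blast
  assume random: "random_design M PX n X Y f \<xi> F \<and> (\<forall>j. sqnorm_X PX F (axis j 1) = 1)"
  then interpret random_design M PX n X Y f \<xi> F
    by blast
  \<comment> \<open>Square integrability of the dictionary comes from its normalization: an integral
    equal to 1 is not the default value 0.\<close>
  have ran: "semi_inner (sqnorm_X PX F)"
    using random by (intro semi_inner_sqnorm_X F_measurable normalized_square_integrable) blast
  show "let N = sqnorm_X PX F;
             a = emp_coef n (\<lambda>i. X i \<omega>) (\<lambda>i. Y i \<omega>) F;
             \<rho> = (\<lambda>j. r j \<epsilon> \<omega>)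
         in (\<forall>\<alpha>. solves_B N a \<rho> \<alpha> \<longrightarrow> solves_A N a \<rho> \<alpha>) \<and>
            (\<forall>\<alpha>bar. oracle_X PX f F \<alpha>bar \<longrightarrow>
               (\<forall>\<alpha> \<alpha>'. solves_A N a \<rho> \<alpha> \<and> solves_A N a \<rho> \<alpha>' \<longrightarrow> N (\<alpha> - \<alpha>bar) = N (\<alpha>' - \<alpha>bar)))"
    unfolding Let_def
    using B_imp_A[OF ran] same_risk[OF ran] by blast
qed

end
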